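(* Every 1-variable TP obstruction contains, as a (not necessarily contiguous) submatrix, a 1-variable TN obstruction.
   Context: A pattern is a rectangular array of positions each marked "specified" or "unspecified"; a line is a row or a column; a submatrix pattern is obtained by choosing any sets of rows and columns. A partial matrix with a pattern assigns real numbers to the specified positions. It is partial TP (resp. partial TN) if every square submatrix consisting only of specified entries has positive (resp. nonnegative) determinant. A pattern is TP-completable (resp. TN-completable) if every partial TP (resp. TN) matrix with that pattern can be completed to a totally positive (resp. totally nonnegative) matrix. A subset $U$ of the unspecified positions is TP-completable (resp. TN-completable) if for every partial TP (resp. TN) matrix with the pattern, real values can be assigned to the positions of $U$ so that the result is still partial TP (resp. TN). The TP-variability (resp. TN-variability) of a non-TP-completable (resp. non-TN-completable) pattern is the smallest size of a subset of its unspecified positions that is not TP-completable (resp. not TN-completable). A row $r$ of a pattern $P$ is a good row if, in the pattern obtained from $P$ by keeping all rows but only the columns in which row $r$ has a specified entry and then declaring those entries of row $r$ unspecified, the set of positions of row $r$ is a TP-completable subset; good columns are defined analogously, and a good line is a good row or good column. A TP obstruction is a pattern that is not TP-completable such that every proper subpattern obtainable from it by repeatedly deleting good lines is TP-completable. A TN obstruction is a pattern that is not TN-completable but every proper submatrix pattern of it is TN-completable. An obstruction is 1-variable if its (TP- resp. TN-) variability is 1. *)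

theory Defs
  imports "Jordan_Normal_Form.Determinant"
begin

text \<open>
  Rows and columns are labelled by finite sets of natural numbers, ordered as naturals, so that
  a submatrix keeps the labels of the ambient array. An array of size m by n is the case
  \<^term>\<open>{..<m}\<close>, \<^term>\<open>{..<n}\<close>.
\<close>

record pattern =
  row_set :: "nat set"
  col_set :: "nat set"
  specified :: "(nat \<times> nat) set"

definition is_pattern :: "pattern \<Rightarrow> bool" where
  "is_pattern P \<longleftrightarrow> finite (row_set P) \<and> finite (col_set P) \<and>
     specified P \<subseteq> row_set P \<times> col_set P"

definition unspecified :: "pattern \<Rightarrow> (nat \<times> nat) set" where
  "unspecified P = row_set P \<times> col_set P - specified P"

text \<open>Meant for \<open>I \<subseteq> row_set P\<close> and \<open>J \<subseteq> col_set P\<close>.\<close>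

definition subpattern :: "pattern \<Rightarrow> nat set \<Rightarrow> nat set \<Rightarrow> pattern" where
  "subpattern P I J = \<lparr>row_set = I, col_set = J, specified = specified P \<inter> (I \<times> J)\<rparr>"

definition specify :: "pattern \<Rightarrow> (nat \<times> nat) set \<Rightarrow> pattern" where
  "specify P U = P\<lparr>specified := specified P \<union> U\<rparr>"

definition unspecify :: "pattern \<Rightarrow> (nat \<times> nat) set \<Rightarrow> pattern" where
  "unspecify P U = P\<lparr>specified := specified P - U\<rparr>"

text \<open>
  A partial matrix is a function on positions of which only the values at specified positions
  are ever inspected. The empty minor is 1.
\<close>

definition minor :: "(nat \<times> nat \<Rightarrow> real) \<Rightarrow> nat set \<Rightarrow> nat set \<Rightarrow> real" where
  "minor A I J = det (mat (card I) (card J)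
     (\<lambda>(i, j). A (sorted_list_of_set I ! i, sorted_list_of_set J ! j)))"

definition totally_positive :: "nat set \<Rightarrow> nat set \<Rightarrow> (nat \<times> nat \<Rightarrow> real) \<Rightarrow> bool" where
  "totally_positive R C A \<longleftrightarrow>
     (\<forall>I J. I \<subseteq> R \<and> J \<subseteq> C \<and> card I = card J \<longrightarrow> minor A I J > 0)"

definition totally_nonnegative :: "nat set \<Rightarrow> nat set \<Rightarrow> (nat \<times> nat \<Rightarrow> real) \<Rightarrow> bool" where
  "totally_nonnegative R C A \<longleftrightarrow>
     (\<forall>I J. I \<subseteq> R \<and> J \<subseteq> C \<and> card I = card J \<longrightarrow> minor A I J \<ge> 0)"

definition partial_TP :: "pattern \<Rightarrow> (nat \<times> nat \<Rightarrow> real) \<Rightarrow> bool" where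
  "partial_TP P A \<longleftrightarrow>
     (\<forall>I J. I \<subseteq> row_set P \<and> J \<subseteq> col_set P \<and> card I = card J \<and> I \<times> J \<subseteq> specified P
        \<longrightarrow> minor A I J > 0)"

definition partial_TN :: "pattern \<Rightarrow> (nat \<times> nat \<Rightarrow> real) \<Rightarrow> bool" where
  "partial_TN P A \<longleftrightarrow>
     (\<forall>I J. I \<subseteq> row_set P \<and> J \<subseteq> col_set P \<and> card I = card J \<and> I \<times> J \<subseteq> specified P
        \<longrightarrow> minor A I J \<ge> 0)"

definition TP_completable :: "pattern \<Rightarrow> bool" where
  "TP_completable P \<longleftrightarrow>
     (\<forall>A. partial_TP P A \<longrightarrow>
        (\<exists>B. (\<forall>p\<in>specified P. B p = A p) \<and> totally_positive (row_set P) (col_set P) B))"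

definition TN_completable :: "pattern \<Rightarrow> bool" where
  "TN_completable P \<longleftrightarrow>
     (\<forall>A. partial_TN P A \<longrightarrow>
        (\<exists>B. (\<forall>p\<in>specified P. B p = A p) \<and> totally_nonnegative (row_set P) (col_set P) B))"

text \<open>Meant for \<open>U \<subseteq> unspecified P\<close>.\<close>

definition TP_completable_subset :: "pattern \<Rightarrow> (nat \<times> nat) set \<Rightarrow> bool" where
  "TP_completable_subset P U \<longleftrightarrow>
     (\<forall>A. partial_TP P A \<longrightarrow>
        (\<exists>B. (\<forall>p\<in>specified P. B p = A p) \<and> partial_TP (specify P U) B))"

definition TN_completable_subset :: "pattern \<Rightarrow> (nat \<times> nat) set \<Rightarrow> bool" where
  "TN_completable_subset P U \<longleftrightarrow>
     (\<forall>A. partial_TN P A \<longrightarrow>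
        (\<exists>B. (\<forall>p\<in>specified P. B p = A p) \<and> partial_TN (specify P U) B))"

text \<open>
  The variabilities are meaningful only for patterns that are not completable; such a pattern
  has a subset as required, namely the set of all its unspecified positions.
\<close>

definition TP_variability :: "pattern \<Rightarrow> nat" where
  "TP_variability P =
     (LEAST k. \<exists>U \<subseteq> unspecified P. \<not> TP_completable_subset P U \<and> card U = k)"

definition TN_variability :: "pattern \<Rightarrow> nat" where
  "TN_variability P =
     (LEAST k. \<exists>U \<subseteq> unspecified P. \<not> TN_completable_subset P U \<and> card U = k)"

definition good_row :: "pattern \<Rightarrow> nat \<Rightarrow> bool" where
  "good_row P r \<longleftrightarrow> r \<in> row_set P \<and>
     (let C = {c \<in> col_set P. (r, c) \<in> specified P}
      in TP_completable_subset (unspecify (subpattern P (row_set P) C) ({r} \<times> C)) ({r} \<times> C))"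

definition good_col :: "pattern \<Rightarrow> nat \<Rightarrow> bool" where
  "good_col P c \<longleftrightarrow> c \<in> col_set P \<and>
     (let R = {r \<in> row_set P. (r, c) \<in> specified P}
      in TP_completable_subset (unspecify (subpattern P R (col_set P)) (R \<times> {c})) (R \<times> {c}))"

inductive good_deletion :: "pattern \<Rightarrow> pattern \<Rightarrow> bool" where
  row: "good_row P r \<Longrightarrow> good_deletion P (subpattern P (row_set P - {r}) (col_set P))"
| col: "good_col P c \<Longrightarrow> good_deletion P (subpattern P (row_set P) (col_set P - {c}))"

text \<open>Goodness of a line is judged in the pattern it is deleted from, not in the original one.\<close>

definition TP_obstruction :: "pattern \<Rightarrow> bool" where
  "TP_obstruction P \<longleftrightarrow> is_pattern P \<and> \<not> TP_completable P \<and>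
     (\<forall>Q. good_deletion\<^sup>+\<^sup>+ P Q \<longrightarrow> TP_completable Q)"

definition TN_obstruction :: "pattern \<Rightarrow> bool" where
  "TN_obstruction P \<longleftrightarrow> is_pattern P \<and> \<not> TN_completable P \<and>
     (\<forall>I J. I \<subseteq> row_set P \<and> J \<subseteq> col_set P \<and> (I, J) \<noteq> (row_set P, col_set P)
        \<longrightarrow> TN_completable (subpattern P I J))"

end

(*
  Suppose P contains no non-TN-completable submatrix pattern with exactly one unspecified entry; we
  show that every single unspecified position u = (r, c) is TP-completable. Excluding the
  two by two patterns with one unspecified diagonal entry forces u into the upper right corner of
  every otherwise specified square submatrix of size at least two (or, symmetrically, into the
  lower left corner of each), and makes these submatrices fill a staircase. Excluding the four by
  four pattern whose upper right corner is the only unspecified entry leaves only sizes one, two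
  and three. Sizes one and three bound u from below, size two from above; the least upper bound
  comes from the nearest row and column, and every lower bound is strictly smaller.

  Thus P has a non-TN-completable submatrix pattern with one unspecified entry, and a
  smallest one is a TN obstruction of variability 1.
*)

theory Submission
  imports Defs
begin

section \<open>Small minors\<close>

text \<open>Laplace expansion along the first row. The smaller determinants are again of the form
  \<open>mat n n\<close>, so simp can iterate the expansion.\<close>

lemma det_mat_Suc:
  "det (mat (Suc n) (Suc n) f :: 'a :: comm_ring_1 mat) =
    (\<Sum>j<Suc n. f (0, j) * ((-1) ^ j *
       det (mat n n (\<lambda>(i, k). f (Suc i, if k < j then k else Suc k)))))"
proof -
  let ?M = "mat (Suc n) (Suc n) f"
  have "mat_delete ?M 0 j = mat n n (\<lambda>(i, k). f (Suc i, if k < j then k else Suc k))"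
    if "j < Suc n" for j
    using that by (auto simp: mat_delete_def)
  then show ?thesis
    by (subst laplace_expansion_row[of ?M "Suc n" 0]) (auto simp: cofactor_def intro!: sum.cong)
qed

lemma minor_card_0: "card I = 0 \<Longrightarrow> card J = 0 \<Longrightarrow> minor A I J = 1"
  by (simp add: minor_def)

lemma minor_1: "minor A {a} {w} = A (a, w)"
  by (simp add: minor_def det_mat_Suc)

lemma minor_2:
  assumes "a < b" "w < x"
  shows "minor A {a, b} {w, x} = A (a, w) * A (b, x) - A (a, x) * A (b, w)"
proof -
  have "sorted_list_of_set {a, b} = [a, b]" "sorted_list_of_set {w, x} = [w, x]"
    using assms by simp_all
  then show ?thesis
    using assms by (simp add: minor_def numeral_2_eq_2 det_mat_Suc)
qed

lemma minor_3:
  assumes "a < b" "b < d" "w < x" "x < y"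
  shows "minor A {a, b, d} {w, x, y} =
    A (a, w) * (A (b, x) * A (d, y) - A (b, y) * A (d, x))
    - A (a, x) * (A (b, w) * A (d, y) - A (b, y) * A (d, w))
    + A (a, y) * (A (b, w) * A (d, x) - A (b, x) * A (d, w))"
proof -
  have "sorted_list_of_set {a, b, d} = [a, b, d]" "sorted_list_of_set {w, x, y} = [w, x, y]"
    using assms by simp_all
  then show ?thesis
    using assms by (simp add: minor_def numeral_3_eq_3 det_mat_Suc algebra_simps)
qed

lemma minor_4:
  assumes "a < b" "b < d" "d < e" "w < x" "x < y" "y < z"
  shows "minor A {a, b, d, e} {w, x, y, z} =
    A (a, w) * minor A {b, d, e} {x, y, z} - A (a, x) * minor A {b, d, e} {w, y, z}
    + A (a, y) * minor A {b, d, e} {w, x, z} - A (a, z) * minor A {b, d, e} {w, x, y}"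
proof -
  have "sorted_list_of_set {a, b, d, e} = [a, b, d, e]"
    "sorted_list_of_set {w, x, y, z} = [w, x, y, z]"
    "card {a, b, d, e} = Suc (Suc (Suc (Suc 0)))" "card {w, x, y, z} = Suc (Suc (Suc (Suc 0)))"
    using assms by simp_all
  then show ?thesis
    using assms by (simp add: minor_3) (simp add: minor_def det_mat_Suc algebra_simps)
qed

lemma minor_cong:
  assumes "card I = card J" and "\<And>i j. i \<in> I \<Longrightarrow> j \<in> J \<Longrightarrow> A (i, j) = B (i, j)"
  shows "minor A I J = minor B I J"
proof -
  \<comment> \<open>An infinite \<open>X\<close> has \<open>card X = 0\<close>, so the bound on
    \<open>k\<close> already yields finiteness.\<close>
  have nth_mem': "sorted_list_of_set X ! k \<in> X" if "k < card X" for X :: "nat set" and k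
    using that by (metis card.infinite length_sorted_list_of_set less_nat_zero_code nth_mem
        set_sorted_list_of_set)
  show ?thesis
    unfolding minor_def using assms
    by (intro arg_cong[of _ _ det]) (auto intro!: eq_matI simp: nth_mem')
qed

lemma minor_transpose:
  assumes "card I = card J"
  shows "minor (A \<circ> prod.swap) J I = minor A I J"
proof -
  let ?M = "mat (card I) (card J) (\<lambda>(i, j). A (sorted_list_of_set I ! i, sorted_list_of_set J ! j))"
  have "minor (A \<circ> prod.swap) J I = det (transpose_mat ?M)"
    unfolding minor_def by (rule arg_cong[of _ _ det]) (auto intro!: eq_matI)
  also have "\<dots> = det ?M"
    by (rule det_transpose[of _ "card I"]) (simp add: assms)
  finally show ?thesis
    by (simp add: minor_def)
qed

text \<open>Splitting off the minimum enumerates small index sets in increasing order, the form in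
  which the explicit minors are stated.\<close>

lemma card_Suc_Min:
  assumes "card (I :: nat set) = Suc n"
  obtains a I' where "I = insert a I'" "card I' = n" "\<And>i. i \<in> I' \<Longrightarrow> a < i"
proof
  have "finite I" "I \<noteq> {}"
    using assms card_ge_0_finite by force+
  then show "I = insert (Min I) (I - {Min I})" "card (I - {Min I}) = n"
    "\<And>i. i \<in> I - {Min I} \<Longrightarrow> Min I < i"
    using assms by (auto simp: insert_absorb le_neq_trans)
qed

lemma card_2_sorted:
  assumes "card (I :: nat set) = 2"
  obtains a b where "a < b" "I = {a, b}"
proof -
  obtain a I' where I: "I = insert a I'" "card I' = 1" "\<And>i. i \<in> I' \<Longrightarrow> a < i"
    using card_Suc_Min[of I 1] assms by auto
  then show ?thesis
    using that by (metis card_1_singletonE insertI1)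
qed

lemma card_3_sorted:
  assumes "card (I :: nat set) = 3"
  obtains a b d where "a < b" "b < d" "I = {a, b, d}"
proof -
  obtain a I' where I: "I = insert a I'" "card I' = 2" "\<And>i. i \<in> I' \<Longrightarrow> a < i"
    using card_Suc_Min[of I 2] assms by auto
  obtain b d where "b < d" "I' = {b, d}"
    using card_2_sorted I(2) by blast
  then show ?thesis
    using that I by auto
qed

text \<open>Serves, with its analogue for triples, to evaluate the minors of the four by four
  witness case by case.\<close>

lemma pair_of_4:
  fixes a b i1 i2 i3 i4 :: nat
  assumes "a < b" "i1 < i2" "i2 < i3" "i3 < i4" "{a, b} \<subseteq> {i1, i2, i3, i4}"
  shows "(a, b) \<in> {(i1, i2), (i1, i3), (i1, i4), (i2, i3), (i2, i4), (i3, i4)}"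
proof -
  have "a \<in> {i1, i2, i3, i4}" "b \<in> {i1, i2, i3, i4}"
    using assms(5) by auto
  then show ?thesis
    using assms(1-4) by (elim insertE emptyE) simp_all
qed

lemma triple_of_4:
  fixes a b d i1 i2 i3 i4 :: nat
  assumes "a < b" "b < d" "i1 < i2" "i2 < i3" "i3 < i4" "{a, b, d} \<subseteq> {i1, i2, i3, i4}"
  shows "(a, b, d) \<in> {(i1, i2, i3), (i1, i2, i4), (i1, i3, i4), (i2, i3, i4)}"
proof -
  have "a \<in> {i1, i2, i3, i4}" "b \<in> {i1, i2, i3, i4}" "d \<in> {i1, i2, i3, i4}"
    using assms(6) by auto
  then show ?thesis
    using assms(1-5) by (elim insertE emptyE) simp_all
qed

section \<open>Patterns\<close>

lemma subpattern_subpattern: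
  assumes "I' \<subseteq> I" "J' \<subseteq> J"
  shows "subpattern (subpattern P I J) I' J' = subpattern P I' J'"
  using assms by (auto simp: subpattern_def)

lemma subpattern_self: "is_pattern P \<Longrightarrow> subpattern P (row_set P) (col_set P) = P"
  by (auto simp: subpattern_def is_pattern_def Int_absorb2)

lemma is_pattern_subpattern:
  assumes "is_pattern P" "I \<subseteq> row_set P" "J \<subseteq> col_set P"
  shows "is_pattern (subpattern P I J)"
  using assms by (auto simp: subpattern_def is_pattern_def intro: finite_subset)

lemma unspecified_subpattern:
  "unspecified (subpattern P I J) = I \<times> J - specified P"
  by (auto simp: unspecified_def subpattern_def)

lemma specified_specify_unspecified:
  "is_pattern P \<Longrightarrow> specified (specify P (unspecified P)) = row_set P \<times> col_set P"
  by (auto simp: is_pattern_def specify_def unspecified_def)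

text \<open>Filling all gaps at once is completing; hence a pattern that is not completable has some
  subset over which the variability minimizes.\<close>

lemma TP_completable_subset_unspecified:
  assumes "is_pattern P"
  shows "TP_completable_subset P (unspecified P) \<longleftrightarrow> TP_completable P"
proof -
  have "partial_TP (specify P (unspecified P)) B \<longleftrightarrow> totally_positive (row_set P) (col_set P) B" for B
    unfolding partial_TP_def totally_positive_def specified_specify_unspecified[OF assms]
    by (auto simp: specify_def)
  then show ?thesis
    by (simp add: TP_completable_subset_def TP_completable_def)
qed

lemma TN_completable_subset_unspecified:
  assumes "is_pattern P"
  shows "TN_completable_subset P (unspecified P) \<longleftrightarrow> TN_completable P"
proof -
  have "partial_TN (specify P (unspecified P)) B \<longleftrightarrow> totally_nonnegative (row_set P) (col_set P) B"
    for B
    unfolding partial_TN_def totally_nonnegative_def specified_specify_unspecified[OF assms]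
    by (auto simp: specify_def)
  then show ?thesis
    by (simp add: TN_completable_subset_def TN_completable_def)
qed

lemma TN_completable_subset_empty: "TN_completable_subset P {}"
  by (auto simp: TN_completable_subset_def specify_def)

text \<open>The only subsets to consider are \<open>{}\<close>, which is always completable, and
  \<open>{u}\<close>, whose filling is a completion.\<close>

lemma TN_variability_single:
  assumes "is_pattern P" "\<not> TN_completable P" "unspecified P = {u}"
  shows "TN_variability P = 1"
  unfolding TN_variability_def
proof (rule Least_equality)
  show "\<exists>U\<subseteq>unspecified P. \<not> TN_completable_subset P U \<and> card U = 1"
    using assms TN_completable_subset_unspecified[OF assms(1)] by auto
  fix k assume "\<exists>U\<subseteq>unspecified P. \<not> TN_completable_subset P U \<and> card U = k"
  then obtain U where U: "U \<subseteq> {u}" "\<not> TN_completable_subset P U" "card U = k"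
    using assms(3) by auto
  then have "U = {u}"
    using TN_completable_subset_empty by (metis subset_singletonD)
  then show "1 \<le> k"
    using U(3) by auto
qed

text \<open>Minimality is left out here; shrinking such a submatrix as far as possible recovers
  it.\<close>

definition has_single_gap_nonTN :: "pattern \<Rightarrow> bool" where
  "has_single_gap_nonTN P \<longleftrightarrow> (\<exists>I J u. I \<subseteq> row_set P \<and> J \<subseteq> col_set P \<and>
     unspecified (subpattern P I J) = {u} \<and> \<not> TN_completable (subpattern P I J))"

text \<open>Among the non-TN-completable submatrices of the given one, take one with the fewest
  lines in total: all its proper submatrices are TN-completable.\<close>

lemma TN_obstruction_if_single_gap:
  assumes P: "is_pattern P" and "has_single_gap_nonTN P"
  shows "\<exists>I J. I \<subseteq> row_set P \<and> J \<subseteq> col_set P \<and>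
    TN_obstruction (subpattern P I J) \<and> TN_variability (subpattern P I J) = 1"
proof -
  obtain I0 J0 u where 0: "I0 \<subseteq> row_set P" "J0 \<subseteq> col_set P"
    "unspecified (subpattern P I0 J0) = {u}" "\<not> TN_completable (subpattern P I0 J0)"
    using assms(2) by (auto simp: has_single_gap_nonTN_def)
  have fin: "finite I0" "finite J0"
    using P 0 by (auto simp: is_pattern_def intro: finite_subset)
  define bad where "bad X \<longleftrightarrow> fst X \<subseteq> I0 \<and> snd X \<subseteq> J0 \<and>
    \<not> TN_completable (subpattern P (fst X) (snd X))" for X
  have "bad (I0, J0)"
    using 0 by (simp add: bad_def)
  then obtain X where X: "bad X"
    and least: "\<And>Y. bad Y \<Longrightarrow> card (fst X) + card (snd X) \<le> card (fst Y) + card (snd Y)"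
    using ex_has_least_nat[of bad "(I0, J0)" "\<lambda>X. card (fst X) + card (snd X)"] by blast
  obtain I J where IJ: "X = (I, J)"
    by (cases X)
  let ?Q = "subpattern P I J"
  have sub: "I \<subseteq> I0" "J \<subseteq> J0" and nc: "\<not> TN_completable ?Q"
    using X by (auto simp: bad_def IJ)
  have pat: "is_pattern ?Q"
    using is_pattern_subpattern[OF P] sub 0 by blast
  have "TN_obstruction ?Q"
    unfolding TN_obstruction_def
  proof (intro conjI allI impI pat nc)
    fix I' J' assume "I' \<subseteq> row_set ?Q \<and> J' \<subseteq> col_set ?Q \<and> (I', J') \<noteq> (row_set ?Q, col_set ?Q)"
    then have sub': "I' \<subseteq> I" "J' \<subseteq> J" "I' \<subset> I \<or> J' \<subset> J"
      by (auto simp: subpattern_def)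
    have "finite I" "finite J"
      using fin sub finite_subset by blast+
    then have "card I' + card J' < card I + card J"
      using sub' by (meson add_le_less_mono add_less_le_mono card_mono psubset_card_mono)
    then have "\<not> bad (I', J')"
      using least[of "(I', J')"] by (auto simp: IJ)
    then show "TN_completable (subpattern ?Q I' J')"
      using sub sub' by (auto simp: bad_def subpattern_subpattern)
  qed
  have "unspecified ?Q \<subseteq> unspecified (subpattern P I0 J0)"
    using sub by (auto simp: unspecified_subpattern)
  \<comment> \<open>A pattern without gaps is completed by the partial matrix itself, so the gap
    \<open>u\<close> survives the shrinking.\<close>
  moreover have "unspecified ?Q \<noteq> {}"
  proof
    assume "unspecified ?Q = {}"
    then show False
      using nc TN_completable_subset_unspecified[OF pat] TN_completable_subset_empty[of ?Q] by simp
  qed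
  ultimately have "unspecified ?Q = {u}"
    by (metis 0(3) subset_singletonD)
  then have "TN_variability ?Q = 1"
    by (rule TN_variability_single[OF pat nc])
  with \<open>TN_obstruction ?Q\<close> show ?thesis
    using sub 0 by blast
qed

section \<open>Transposition\<close>

text \<open>Transposition exchanges upper right and lower left corners, so only one of these two
  cases for the gap has to be worked out.\<close>

definition transpose_pattern :: "pattern \<Rightarrow> pattern" where
  "transpose_pattern P =
     \<lparr>row_set = col_set P, col_set = row_set P, specified = (specified P)\<inverse>\<rparr>"

lemma transpose_pattern_simps [simp]:
  "row_set (transpose_pattern P) = col_set P"
  "col_set (transpose_pattern P) = row_set P"
  "specified (transpose_pattern P) = (specified P)\<inverse>"
  by (simp_all add: transpose_pattern_def)

lemma transpose_transpose_pattern [simp]: "transpose_pattern (transpose_pattern P) = P"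
  by (simp add: transpose_pattern_def)

lemma transpose_subpattern:
  "transpose_pattern (subpattern P I J) = subpattern (transpose_pattern P) J I"
  by (auto simp: transpose_pattern_def subpattern_def)

lemma transpose_specify:
  "transpose_pattern (specify P U) = specify (transpose_pattern P) (U\<inverse>)"
  by (auto simp: transpose_pattern_def specify_def)

lemma is_pattern_transpose: "is_pattern P \<Longrightarrow> is_pattern (transpose_pattern P)"
  by (auto simp: is_pattern_def)

lemma converse_singleton: "{(a, b)}\<inverse> = {(b, a)}"
  by auto

lemma times_subset_converse_iff: "J \<times> I \<subseteq> R\<inverse> \<longleftrightarrow> I \<times> J \<subseteq> R"
  by blast

lemma partial_TP_transpose:
  assumes "partial_TP P A"
  shows "partial_TP (transpose_pattern P) (A \<circ> prod.swap)"
  unfolding partial_TP_def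
proof (intro allI impI, elim conjE)
  fix J I
  assume *: "J \<subseteq> row_set (transpose_pattern P)" "I \<subseteq> col_set (transpose_pattern P)"
    "card J = card I" "J \<times> I \<subseteq> specified (transpose_pattern P)"
  then have "0 < minor A I J"
    using assms by (simp add: partial_TP_def times_subset_converse_iff)
  then show "0 < minor (A \<circ> prod.swap) J I"
    using * by (simp add: minor_transpose)
qed

lemma partial_TN_transpose:
  assumes "partial_TN P A"
  shows "partial_TN (transpose_pattern P) (A \<circ> prod.swap)"
  unfolding partial_TN_def
proof (intro allI impI, elim conjE)
  fix J I
  assume *: "J \<subseteq> row_set (transpose_pattern P)" "I \<subseteq> col_set (transpose_pattern P)"
    "card J = card I" "J \<times> I \<subseteq> specified (transpose_pattern P)"
  then have "0 \<le> minor A I J"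
    using assms by (simp add: partial_TN_def times_subset_converse_iff)
  then show "0 \<le> minor (A \<circ> prod.swap) J I"
    using * by (simp add: minor_transpose)
qed

lemma totally_nonnegative_transpose:
  assumes "totally_nonnegative R C A"
  shows "totally_nonnegative C R (A \<circ> prod.swap)"
  using assms by (simp add: totally_nonnegative_def minor_transpose)

lemma TN_completable_transpose:
  assumes "TN_completable P"
  shows "TN_completable (transpose_pattern P)"
  unfolding TN_completable_def
proof (intro allI impI)
  fix A assume "partial_TN (transpose_pattern P) A"
  then have "partial_TN P (A \<circ> prod.swap)"
    using partial_TN_transpose by fastforce
  then obtain B where "\<forall>p\<in>specified P. B p = (A \<circ> prod.swap) p"
    "totally_nonnegative (row_set P) (col_set P) B"
    using assms by (auto simp: TN_completable_def)
  then show "\<exists>B. (\<forall>p\<in>specified (transpose_pattern P). B p = A p) \<and>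
      totally_nonnegative (row_set (transpose_pattern P)) (col_set (transpose_pattern P)) B"
    using totally_nonnegative_transpose by (intro exI[of _ "B \<circ> prod.swap"]) auto
qed

lemma has_single_gap_nonTN_transpose:
  assumes "has_single_gap_nonTN (transpose_pattern P)"
  shows "has_single_gap_nonTN P"
proof -
  obtain J I u where *: "J \<subseteq> col_set P" "I \<subseteq> row_set P"
    "unspecified (subpattern (transpose_pattern P) J I) = {u}"
    "\<not> TN_completable (subpattern (transpose_pattern P) J I)"
    using assms by (auto simp: has_single_gap_nonTN_def)
  have "unspecified (subpattern P I J) = {prod.swap u}"
  proof -
    have "unspecified (subpattern P I J) =
        prod.swap ` unspecified (subpattern (transpose_pattern P) J I)"
      unfolding unspecified_subpattern by force
    then show ?thesis
      using *(3) by simp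
  qed
  moreover have "\<not> TN_completable (subpattern P I J)"
    using *(4) TN_completable_transpose transpose_subpattern by metis
  ultimately show ?thesis
    using * unfolding has_single_gap_nonTN_def by blast
qed

section \<open>Two patterns with one unspecified entry that are not TN-completable\<close>

text \<open>With ones off the diagonal and a zero at the specified diagonal entry, the full minor is
  -1 whatever value fills the gap.\<close>

lemma not_TN_completable_diagonal_2:
  assumes "i < i'" "j < j'" and u: "u = (i, j) \<or> u = (i', j')"
    and Q: "row_set Q = {i, i'}" "col_set Q = {j, j'}" "specified Q = {i, i'} \<times> {j, j'} - {u}"
  shows "\<not> TN_completable Q"
proof
  define A :: "nat \<times> nat \<Rightarrow> real" where "A = (\<lambda>p. if p \<in> {(i, j), (i', j')} then 0 else 1)"
  assume "TN_completable Q"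
  moreover have "partial_TN Q A"
    unfolding partial_TN_def
  proof (intro allI impI, elim conjE)
    fix I J
    assume *: "I \<subseteq> row_set Q" "J \<subseteq> col_set Q" "card I = card J" "I \<times> J \<subseteq> specified Q"
    have fin: "finite I" "finite J"
      using *(1,2) Q by (auto intro: finite_subset)
    have le: "card I \<le> 2" "card J \<le> 2"
      using card_mono[of "{i, i'}" I] card_mono[of "{j, j'}" J] *(1,2) Q assms by auto
    have "card I \<noteq> 2"
    proof
      assume "card I = 2"
      then have "I = {i, i'}" "J = {j, j'}"
        using * Q assms card_subset_eq[of "{i, i'}" I] card_subset_eq[of "{j, j'}" J] by simp_all
      then show False
        using *(4) u Q by auto
    qed
    then consider "card I = 0" | "card I = 1"
      using le by linarith
    then show "0 \<le> minor A I J"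
    proof cases
      case 1
      then show ?thesis using * by (simp add: minor_card_0)
    next
      case 2
      then obtain a w where "I = {a}" "J = {w}"
        using * by (metis card_1_singletonE)
      then show ?thesis by (simp add: minor_1 A_def)
    qed
  qed
  ultimately obtain B where B: "\<forall>p\<in>specified Q. B p = A p"
    "totally_nonnegative {i, i'} {j, j'} B"
    unfolding TN_completable_def Q(1,2) by blast
  have "0 \<le> minor B {i, i'} {j, j'}"
    using B(2) assms unfolding totally_nonnegative_def by auto
  moreover have "B (i, j') = 1" "B (i', j) = 1" "B (i, j) = 0 \<or> B (i', j') = 0"
    using B(1) u assms(1,2) unfolding Q(3) by (auto simp: A_def)
  ultimately show False
    using assms by (auto simp: minor_2)
qed

text \<open>
  The witness has rows 1 1 0 u / 1 2 1 0 / 0 1 1 1 / 0 0 1 2 with u missing; its determinant is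
  \<open>- 1 - u\<close>, while the entry u itself has to be nonnegative.
\<close>

lemma not_TN_completable_corner_4:
  assumes less: "i1 < i2" "i2 < i3" "i3 < i4" "j1 < j2" "j2 < j3" "j3 < j4"
    and Q: "row_set Q = {i1, i2, i3, i4}" "col_set Q = {j1, j2, j3, j4}"
      "specified Q = {i1, i2, i3, i4} \<times> {j1, j2, j3, j4} - {(i1, j4)}"
  shows "\<not> TN_completable Q"
proof
  \<comment> \<open>The value 0 at \<open>(i1, j4)\<close> is a dummy: this position is the
    gap.\<close>
  define A :: "nat \<times> nat \<Rightarrow> real" where
    "A = (\<lambda>p. if p \<in> {(i2, j2), (i4, j4)} then 2
       else if p \<in> {(i1, j3), (i1, j4), (i2, j4), (i3, j1), (i4, j1), (i4, j2)} then 0 else 1)"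
  have neq: "i1 \<noteq> i2" "i1 \<noteq> i3" "i1 \<noteq> i4" "i2 \<noteq> i3" "i2 \<noteq> i4" "i3 \<noteq> i4"
    "j1 \<noteq> j2" "j1 \<noteq> j3" "j1 \<noteq> j4" "j2 \<noteq> j3" "j2 \<noteq> j4" "j3 \<noteq> j4"
    using less by auto
  note neqs = neq neq[symmetric]
  have vals:
    "A (i1, j1) = 1" "A (i1, j2) = 1" "A (i1, j3) = 0" "A (i1, j4) = 0"
    "A (i2, j1) = 1" "A (i2, j2) = 2" "A (i2, j3) = 1" "A (i2, j4) = 0"
    "A (i3, j1) = 0" "A (i3, j2) = 1" "A (i3, j3) = 1" "A (i3, j4) = 1"
    "A (i4, j1) = 0" "A (i4, j2) = 0" "A (i4, j3) = 1" "A (i4, j4) = 2"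
    by (simp_all add: A_def neqs)
  assume "TN_completable Q"
  moreover have "partial_TN Q A"
    unfolding partial_TN_def
  proof (intro allI impI, elim conjE)
    fix I J
    assume *: "I \<subseteq> row_set Q" "J \<subseteq> col_set Q" "card I = card J" "I \<times> J \<subseteq> specified Q"
    have gap: "\<not> (i1 \<in> I \<and> j4 \<in> J)"
      using *(4) Q by auto
    have "card I \<le> 4"
      using card_mono[of "{i1, i2, i3, i4}" I] *(1) Q neq by auto
    moreover have "card I \<noteq> 4"
    proof
      assume "card I = 4"
      then have "I = {i1, i2, i3, i4}" "J = {j1, j2, j3, j4}"
        using * Q neq card_subset_eq[of "{i1, i2, i3, i4}" I] card_subset_eq[of "{j1, j2, j3, j4}" J]
        by simp_all
      then show False
        using gap by auto
    qed
    ultimately consider "card I = 0" | "card I = 1" | "card I = 2" | "card I = 3"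
      by linarith
    then show "0 \<le> minor A I J"
    proof cases
      case 1
      then show ?thesis using * by (simp add: minor_card_0)
    next
      case 2
      then obtain a w where "I = {a}" "J = {w}"
        using * by (metis card_1_singletonE)
      then show ?thesis by (simp add: minor_1 A_def)
    next
      case 3
      obtain a b where I: "a < b" "I = {a, b}"
        using card_2_sorted 3 by blast
      obtain w x where J: "w < x" "J = {w, x}"
        using card_2_sorted 3 *(3) by metis
      have "(a, b) \<in> {(i1, i2), (i1, i3), (i1, i4), (i2, i3), (i2, i4), (i3, i4)}"
        using *(1) unfolding I Q(1) by (rule pair_of_4[OF I(1) less(1-3)])
      moreover have "(w, x) \<in> {(j1, j2), (j1, j3), (j1, j4), (j2, j3), (j2, j4), (j3, j4)}"
        using *(2) unfolding J Q(2) by (rule pair_of_4[OF J(1) less(4-6)])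
      ultimately show ?thesis
        using gap unfolding I(2) J(2) minor_2[OF I(1) J(1)]
        by (elim insertE) (simp_all add: vals)
    next
      case 4
      obtain a b d where I: "a < b" "b < d" "I = {a, b, d}"
        using card_3_sorted 4 by blast
      obtain w x y where J: "w < x" "x < y" "J = {w, x, y}"
        using card_3_sorted 4 *(3) by metis
      have "(a, b, d) \<in> {(i1, i2, i3), (i1, i2, i4), (i1, i3, i4), (i2, i3, i4)}"
        using *(1) unfolding I Q(1) by (rule triple_of_4[OF I(1,2) less(1-3)])
      moreover have "(w, x, y) \<in> {(j1, j2, j3), (j1, j2, j4), (j1, j3, j4), (j2, j3, j4)}"
        using *(2) unfolding J Q(2) by (rule triple_of_4[OF J(1,2) less(4-6)])
      ultimately show ?thesis
        using gap unfolding I(3) J(3) minor_3[OF I(1,2) J(1,2)]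
        by (elim insertE) (simp_all add: vals)
    qed
  qed
  ultimately obtain B where B: "\<forall>p\<in>specified Q. B p = A p"
    "totally_nonnegative {i1, i2, i3, i4} {j1, j2, j3, j4} B"
    unfolding TN_completable_def Q(1,2) by blast
  have "0 \<le> minor B {i1} {j4}" "0 \<le> minor B {i1, i2, i3, i4} {j1, j2, j3, j4}"
    using B(2) neq unfolding totally_nonnegative_def by auto
  moreover have "B (i, j) = A (i, j)"
    if "i \<in> {i1, i2, i3, i4}" "j \<in> {j1, j2, j3, j4}" "i \<noteq> i1 \<or> j \<noteq> j4" for i j
    using B(1) that unfolding Q(3) by auto
  ultimately show False
    using less by (simp add: minor_1 minor_3 minor_4 vals neqs)
qed

section \<open>Filling one position\<close>

text \<open>
  In the two lemmas below, the value of \<open>u\<close> makes a two by two minor vanish, so one line of the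
  three by three matrix is, up to a positive factor, the sum of a multiple of a line of the
  partial matrix and of a multiple of a unit vector.
\<close>

lemma det_3_pos_col:
  fixes aw :: real
  assumes "0 < b_y" "0 < bc" and u: "u * b_y = ay * bc"
    and ab: "0 < aw * bx - ax * bw" and bd: "0 < b_y * dc - bc * dy"
    and full: "0 \<le> aw * (bx * dy - b_y * dx) - ax * (bw * dy - b_y * dw) + ay * (bw * dx - bx * dw)"
  shows "0 < aw * (bx * dc - bc * dx) - ax * (bw * dc - bc * dw) + u * (bw * dx - bx * dw)"
    (is "0 < ?d")
proof -
  \<comment> \<open>\<open>b_y\<close> times the last column is \<open>bc\<close> times the column
    \<open>(ay, b_y, dy)\<close> plus a vector supported in the last entry, whose cofactor is
    \<open>aw * bx - ax * bw\<close>. The choice of \<open>u\<close> cancels the remainder in the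
    first entry.\<close>
  have "b_y * ?d = bc * (aw * (bx * dy - b_y * dx) - ax * (bw * dy - b_y * dw)
      + ay * (bw * dx - bx * dw)) + (b_y * dc - bc * dy) * (aw * bx - ax * bw)
      + (u * b_y - ay * bc) * (bw * dx - bx * dw)"
    by (simp add: algebra_simps)
  also have "\<dots> > 0"
    using assms by (simp add: add_nonneg_pos)
  finally show ?thesis
    using assms(1) by (simp add: zero_less_mult_iff)
qed

lemma det_3_pos_row:
  fixes aw :: real
  assumes "0 < bx" "0 < ax" and u: "u * bx = ax * bc"
    and ab: "0 < aw * bx - ax * bw" and de: "0 < dx * ec - dc * ex"
    and full: "0 \<le> bw * (dx * ec - dc * ex) - bx * (dw * ec - dc * ew) + bc * (dw * ex - dx * ew)"
  shows "0 < aw * (dx * ec - dc * ex) - ax * (dw * ec - dc * ew) + u * (dw * ex - dx * ew)"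
    (is "0 < ?d")
proof -
  \<comment> \<open>Here \<open>bx\<close> times the first row is \<open>ax\<close> times the row
    \<open>(bw, bx, bc)\<close> plus a vector supported in the first entry, with cofactor
    \<open>dx * ec - dc * ex\<close>.\<close>
  have "bx * ?d = ax * (bw * (dx * ec - dc * ex) - bx * (dw * ec - dc * ew)
      + bc * (dw * ex - dx * ew)) + (aw * bx - ax * bw) * (dx * ec - dc * ex)
      + (u * bx - ax * bc) * (dw * ex - dx * ew)"
    by (simp add: algebra_simps)
  also have "\<dots> > 0"
    using assms by (simp add: add_nonneg_pos)
  finally show ?thesis
    using assms(1) by (simp add: zero_less_mult_iff)
qed

section \<open>Closure properties of the specified positions\<close>

text \<open>Turns a pattern that is not TN-completable into a closure property: were
  \<open>u\<close> missing, it would be the only gap of the submatrix on \<open>I\<close> and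
  \<open>J\<close>, contrary to the first assumption.\<close>

lemma specified_if_no_gap:
  assumes "\<not> has_single_gap_nonTN P" "is_pattern P" "I \<subseteq> row_set P" "J \<subseteq> col_set P"
    and "u \<in> I \<times> J" "I \<times> J - {u} \<subseteq> specified P"
    and nc: "\<And>Q. row_set Q = I \<Longrightarrow> col_set Q = J \<Longrightarrow> specified Q = I \<times> J - {u} \<Longrightarrow>
      \<not> TN_completable Q"
  shows "u \<in> specified P"
proof (rule ccontr)
  assume u: "u \<notin> specified P"
  then have "unspecified (subpattern P I J) = {u}"
    using assms(5,6) by (auto simp: unspecified_subpattern)
  moreover have "specified (subpattern P I J) = I \<times> J - {u}"
    using assms(6) u by (auto simp: subpattern_def)
  then have "\<not> TN_completable (subpattern P I J)"
    by (intro nc) (simp_all add: subpattern_def)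
  ultimately show False
    using assms(1,3,4) unfolding has_single_gap_nonTN_def by blast
qed

lemma specified_upper_left:
  assumes "\<not> has_single_gap_nonTN P" "is_pattern P" "i < i'" "j < j'"
    and "(i, j') \<in> specified P" "(i', j) \<in> specified P" "(i', j') \<in> specified P"
  shows "(i, j) \<in> specified P"
proof (rule specified_if_no_gap[OF assms(1,2)])
  show "{i, i'} \<subseteq> row_set P" "{j, j'} \<subseteq> col_set P"
    using assms(2,5-7) unfolding is_pattern_def by blast+
  show "{i, i'} \<times> {j, j'} - {(i, j)} \<subseteq> specified P"
    using assms(5-7) by blast
qed (simp, rule not_TN_completable_diagonal_2[OF assms(3,4), where u = "(i, j)"], simp_all)

lemma specified_lower_right:
  assumes "\<not> has_single_gap_nonTN P" "is_pattern P" "i < i'" "j < j'"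
    and "(i, j) \<in> specified P" "(i, j') \<in> specified P" "(i', j) \<in> specified P"
  shows "(i', j') \<in> specified P"
proof (rule specified_if_no_gap[OF assms(1,2)])
  show "{i, i'} \<subseteq> row_set P" "{j, j'} \<subseteq> col_set P"
    using assms(2,5-7) unfolding is_pattern_def by blast+
  show "{i, i'} \<times> {j, j'} - {(i', j')} \<subseteq> specified P"
    using assms(5-7) by blast
qed (simp, rule not_TN_completable_diagonal_2[OF assms(3,4), where u = "(i', j')"], simp_all)

lemma specified_corner_4:
  assumes "\<not> has_single_gap_nonTN P" "is_pattern P"
    and "i1 < i2" "i2 < i3" "i3 < i4" "j1 < j2" "j2 < j3" "j3 < j4"
    and sub: "{i1, i2, i3, i4} \<times> {j1, j2, j3, j4} - {(i1, j4)} \<subseteq> specified P"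
  shows "(i1, j4) \<in> specified P"
proof (rule specified_if_no_gap[OF assms(1,2) _ _ _ sub])
  \<comment> \<open>The first column and the last row avoid the gap, so their specified positions
    show that all labels belong to \<open>P\<close>.\<close>
  have "(i, j1) \<in> specified P" "(i4, j) \<in> specified P"
    if "i \<in> {i1, i2, i3, i4}" "j \<in> {j1, j2, j3, j4}" for i j
  proof -
    have "(i, j1) \<noteq> (i1, j4)" "(i4, j) \<noteq> (i1, j4)"
      using assms(3-8) by simp_all
    then show "(i, j1) \<in> specified P" "(i4, j) \<in> specified P"
      using sub that by blast+
  qed
  then show "{i1, i2, i3, i4} \<subseteq> row_set P" "{j1, j2, j3, j4} \<subseteq> col_set P"
    using assms(2) unfolding is_pattern_def by blast+
qed (simp, rule not_TN_completable_corner_4[OF assms(3-8)])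

section \<open>A gap in upper right corners\<close>

text \<open>The last assumption keeps the gap out of lower left corners of otherwise specified two
  by two submatrices; the closure properties keep it out of the two diagonal corners.\<close>

locale upper_right_gap =
  fixes P :: pattern and A :: "nat \<times> nat \<Rightarrow> real" and r c :: nat
  assumes no_gap: "\<not> has_single_gap_nonTN P" and pat: "is_pattern P"
    and TP: "partial_TP P A"
    and gap: "r \<in> row_set P" "c \<in> col_set P" "(r, c) \<notin> specified P"
    and no_lower_left: "\<And>i j. i < r \<Longrightarrow> c < j \<Longrightarrow> (i, c) \<in> specified P \<Longrightarrow> (r, j) \<in> specified P \<Longrightarrow>
      (i, j) \<notin> specified P"
begin

abbreviation S where "S \<equiv> specified P"

lemma S_sub: "S \<subseteq> row_set P \<times> col_set P"
  using pat by (simp add: is_pattern_def)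

lemma minor_pos:
  assumes "card I = card J" "I \<times> J \<subseteq> S" "I \<noteq> {}" "J \<noteq> {}"
  shows "0 < minor A I J"
proof -
  have "I \<subseteq> row_set P" "J \<subseteq> col_set P"
    using assms S_sub by auto
  then show ?thesis
    using TP assms by (simp add: partial_TP_def)
qed

lemma pos_1: "(i, j) \<in> S \<Longrightarrow> 0 < A (i, j)"
  using minor_pos[of "{i}" "{j}"] by (simp add: minor_1)

lemma pos_2:
  assumes "a < b" "w < x" "{a, b} \<times> {w, x} \<subseteq> S"
  shows "0 < A (a, w) * A (b, x) - A (a, x) * A (b, w)"
  using minor_pos[of "{a, b}" "{w, x}"] assms by (simp add: minor_2)

lemma pos_3:
  assumes "a < b" "b < d" "w < x" "x < y" "{a, b, d} \<times> {w, x, y} \<subseteq> S"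
  shows "0 < A (a, w) * (A (b, x) * A (d, y) - A (b, y) * A (d, x))
    - A (a, x) * (A (b, w) * A (d, y) - A (b, y) * A (d, w))
    + A (a, y) * (A (b, w) * A (d, x) - A (b, x) * A (d, w))"
  using minor_pos[of "{a, b, d}" "{w, x, y}"] assms by (simp add: minor_3)

text \<open>Each such pair gives the upper bound \<open>A (r, j) * A (i, c) / A (i, j)\<close> on
  the missing entry.\<close>

definition quad :: "nat \<Rightarrow> nat \<Rightarrow> bool" where
  "quad i j \<longleftrightarrow> r < i \<and> j < c \<and> (i, c) \<in> S \<and> (r, j) \<in> S \<and> (i, j) \<in> S"

text \<open>The pairs with \<^term>\<open>quad i j\<close> form a staircase.\<close>

lemma quad_up:
  assumes "quad i' j" "r < i" "i \<le> i'" "(i, c) \<in> S"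
  shows "quad i j"
proof (cases "i = i'")
  case False
  then have "(i, j) \<in> S"
    using assms specified_upper_left[OF no_gap pat, of i i' j c] by (simp add: quad_def)
  then show ?thesis
    using assms by (simp add: quad_def)
qed (use assms in simp)

lemma quad_right:
  assumes "quad i j'" "j < c" "j' \<le> j" "(r, j) \<in> S"
  shows "quad i j"
proof (cases "j = j'")
  case False
  then have "(i, j) \<in> S"
    using assms specified_lower_right[OF no_gap pat, of r i j' j] by (simp add: quad_def)
  then show ?thesis
    using assms by (simp add: quad_def)
qed (use assms in simp)

text \<open>The minor on rows \<open>r, i, i'\<close> and columns \<open>j, j', c\<close> with
  \<open>v\<close> in the gap. On a \<open>block_3\<close> the coefficient of \<open>v\<close> is a
  positive minor, so positivity bounds \<open>v\<close> from below.\<close>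

definition det_3 :: "nat \<Rightarrow> nat \<Rightarrow> nat \<Rightarrow> nat \<Rightarrow> real \<Rightarrow> real" where
  "det_3 i i' j j' v =
    A (r, j) * (A (i, j') * A (i', c) - A (i, c) * A (i', j'))
    - A (r, j') * (A (i, j) * A (i', c) - A (i, c) * A (i', j))
    + v * (A (i, j) * A (i', j') - A (i, j') * A (i', j))"

definition block_3 :: "nat \<Rightarrow> nat \<Rightarrow> nat \<Rightarrow> nat \<Rightarrow> bool" where
  "block_3 i i' j j' \<longleftrightarrow> i < i' \<and> j < j' \<and> quad i j \<and> quad i j' \<and> quad i' j \<and> quad i' j'"

text \<open>Equivalently, \<open>A (i, c) / A (i, j)\<close> grows with \<open>i\<close>: nearer
  rows give tighter upper bounds.\<close>

lemma quad_induced_minor: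
  assumes "i < i'" "quad i j" "quad i' j"
  shows "A (i, c) * A (i', j) < A (i', c) * A (i, j)"
  using assms pos_2[of i i' j c] by (auto simp: quad_def algebra_simps)

text \<open>Equivalently, \<open>A (r, j) / A (i, j)\<close> decreases with \<open>j\<close>: nearer
  columns give tighter upper bounds.\<close>

lemma quad_induced_minor':
  assumes "j < j'" "quad i j" "quad i j'"
  shows "A (r, j') * A (i, j) < A (r, j) * A (i, j')"
  using assms pos_2[of r i j j'] by (auto simp: quad_def algebra_simps)

text \<open>Row \<open>r\<close> and column \<open>c\<close> would complete this to the excluded
  four by four pattern. Hence minors through the gap have size at most three.\<close>

lemma no_4_block:
  assumes "i1 < i2" "i2 < i3" "j1 < j2" "j2 < j3"
    and "\<And>i j. i \<in> {i1, i2, i3} \<Longrightarrow> j \<in> {j1, j2, j3} \<Longrightarrow> quad i j"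
  shows False
proof -
  have "r < i1" "j3 < c"
    using assms by (auto simp: quad_def)
  moreover have "{r, i1, i2, i3} \<times> {j1, j2, j3, c} - {(r, c)} \<subseteq> S"
    using assms(5) unfolding quad_def by blast
  ultimately show False
    using specified_corner_4[OF no_gap pat _ assms(1,2) assms(3,4)] gap by blast
qed

text \<open>
  Among all specified two by two minors around the gap, the one using the nearest row \<open>p\<close> and
  the nearest column \<open>y\<close> gives the least upper bound for the missing entry.
\<close>

lemma least_upper_bound:
  assumes py: "quad p y" and p: "\<forall>i. r < i \<longrightarrow> (i, c) \<in> S \<longrightarrow> p \<le> i"
    and y: "\<forall>j. j < c \<longrightarrow> (r, j) \<in> S \<longrightarrow> j \<le> y"
    and u: "u * A (p, y) = A (r, y) * A (p, c)"
  shows "quad i j \<Longrightarrow> u * A (i, j) \<le> A (r, j) * A (i, c)"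
    and "block_3 i i' j j' \<Longrightarrow> 0 < det_3 i i' j j' u"
proof -
  have quad_y: "quad i y" if "quad i j" for i j
    using quad_right[OF that, of y] py y that by (auto simp: quad_def)
  have quad_p: "quad p j" if "quad i j" for i j
    using quad_up[OF that, of p] py p that by (auto simp: quad_def)
  have pos: "0 < A (p, y)" "0 < A (r, y)" "0 < A (p, c)"
    using py pos_1 by (auto simp: quad_def)
  {
    assume ij: "quad i j"
    have le: "p \<le> i" "j \<le> y"
      using ij p y by (auto simp: quad_def)
    have pos': "0 < A (r, j)" "0 < A (i, y)" "0 < A (i, c)"
      using ij quad_y[OF ij] pos_1 by (auto simp: quad_def)
    \<comment> \<open>Pass from column \<open>j\<close> to the nearest column \<open>y\<close>, then
      from row \<open>i\<close> to the nearest row \<open>p\<close>; neither move weakens the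
      bound.\<close>
    have 1: "A (r, y) * A (i, j) \<le> A (r, j) * A (i, y)"
      using quad_induced_minor'[of j y i] le ij quad_y[OF ij] by (cases "j = y") auto
    have 2: "A (p, c) * A (i, y) \<le> A (i, c) * A (p, y)"
      using quad_induced_minor[of p i y] le py quad_y[OF ij] by (cases "i = p") auto
    have "A (p, y) * (u * A (i, j)) = A (p, c) * (A (r, y) * A (i, j))"
      using u by (simp add: algebra_simps)
    also have "\<dots> \<le> A (p, c) * (A (r, j) * A (i, y))"
      using 1 pos by simp
    also have "\<dots> = A (r, j) * (A (p, c) * A (i, y))"
      by simp
    also have "\<dots> \<le> A (r, j) * (A (i, c) * A (p, y))"
      using 2 pos' by simp
    finally have "A (p, y) * (u * A (i, j)) \<le> A (p, y) * (A (r, j) * A (i, c))"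
      by (simp add: algebra_simps)
    then show "u * A (i, j) \<le> A (r, j) * A (i, c)"
      using pos by simp
  }
  {
    assume block: "block_3 i i' j j'"
    then have b: "i < i'" "j < j'" "quad i j" "quad i j'" "quad i' j" "quad i' j'"
      by (auto simp: block_3_def)
    then have S: "r < i" "j' < c" "{i, i'} \<times> {j, j', c} \<subseteq> S" "(r, j) \<in> S" "(r, j') \<in> S"
      by (auto simp: quad_def)
    have le: "p \<le> i" "j' \<le> y"
      using b p y by (auto simp: quad_def)
    have qs: "quad i y" "quad i' y" "quad p j" "quad p j'"
      using quad_y[OF b(3)] quad_y[OF b(5)] quad_p[OF b(3)] quad_p[OF b(4)] by auto
    have ySp: "y < c" "r < p" "(r, y) \<in> S" "(i, y) \<in> S" "(i', y) \<in> S"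
      "(p, c) \<in> S" "(p, j) \<in> S" "(p, j') \<in> S"
      using qs py by (auto simp: quad_def)
    \<comment> \<open>If \<open>p\<close> and \<open>y\<close> were both new lines, rows
      \<open>p, i, i'\<close> and columns \<open>j, j', y\<close> would form the excluded block. So
      the block contains row \<open>p\<close> or column \<open>y\<close>.\<close>
    consider "p = i" | "p < i" "j' = y" | "p < i" "j' < y"
      using le by linarith
    then show "0 < det_3 i i' j j' u"
    proof cases
      case 1
      \<comment> \<open>Column \<open>c\<close> is compared with column \<open>y\<close>. The minor
        with \<open>y\<close> in place of \<open>c\<close> is fully specified and positive, or zero
        by a repeated column if \<open>j' = y\<close>.\<close>
      have full: "0 \<le> A (r, j) * (A (i, j') * A (i', y) - A (i, y) * A (i', j'))
          - A (r, j') * (A (i, j) * A (i', y) - A (i, y) * A (i', j))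
          + A (r, y) * (A (i, j) * A (i', j') - A (i, j') * A (i', j))"
      proof (cases "j' = y")
        case True
        then show ?thesis by (simp add: algebra_simps)
      next
        case False
        have "{r, i, i'} \<times> {j, j', y} \<subseteq> S"
          using S ySp by blast
        then show ?thesis
          using False le b S pos_3[of r i i' j j' y] by linarith
      qed
      have "{r, i} \<times> {j, j'} \<subseteq> S" "{i, i'} \<times> {y, c} \<subseteq> S"
        using S ySp by blast+
      then have "0 < A (r, j) * A (i, j') - A (r, j') * A (i, j)"
        "0 < A (i, y) * A (i', c) - A (i, c) * A (i', y)"
        using pos_2[of r i j j'] pos_2[of i i' y c] b S ySp by auto
      then show ?thesis
        unfolding det_3_def using pos u full 1
        by (intro det_3_pos_col[where ay = "A (r, y)" and b_y = "A (i, y)" and dy = "A (i', y)"])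
          auto
    next
      case 2
      \<comment> \<open>Dually, row \<open>r\<close> is compared with row \<open>p\<close>; as
        \<open>p < i\<close>, the minor on rows \<open>p, i, i'\<close> is a specified minor of
        \<open>A\<close>.\<close>
      have "{p, i, i'} \<times> {j, j', c} \<subseteq> S" "{r, p} \<times> {j, j'} \<subseteq> S" "{i, i'} \<times> {j', c} \<subseteq> S"
        using S ySp by blast+
      then show ?thesis
        unfolding det_3_def using pos u 2 b S ySp
          pos_3[of p i i' j j' c] pos_2[of r p j j'] pos_2[of i i' j' c]
        by (intro det_3_pos_row[where bx = "A (p, j')" and bw = "A (p, j)" and bc = "A (p, c)"])
          auto
    next
      case 3
      then show ?thesis
        using no_4_block[of p i i' j j' y] b qs py by blast
    qed
  }
qed

lemma finite_block_3: "finite {(i, i', j, j'). block_3 i i' j j'}"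
proof (rule finite_subset)
  show "{(i, i', j, j'). block_3 i i' j j'} \<subseteq> row_set P \<times> row_set P \<times> col_set P \<times> col_set P"
    using S_sub by (auto simp: block_3_def quad_def)
  show "finite (row_set P \<times> row_set P \<times> col_set P \<times> col_set P)"
    using pat by (simp add: is_pattern_def)
qed

text \<open>At the least upper bound \<open>u\<close> the three by three conditions hold strictly.
  They are finitely many and continuous in \<open>v\<close>, so they persist slightly below
  \<open>u\<close>, where the two by two conditions become strict too.\<close>

lemma ex_value:
  "\<exists>v>0. (\<forall>i j. quad i j \<longrightarrow> v * A (i, j) < A (r, j) * A (i, c)) \<and>
     (\<forall>i i' j j'. block_3 i i' j j' \<longrightarrow> 0 < det_3 i i' j j' v)"
proof (cases "\<exists>i j. quad i j")
  case False
  then show ?thesis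
    \<comment> \<open>Without two by two conditions there are no blocks either, and any positive
      value works.\<close>
    by (intro exI[of _ 1]) (auto simp: block_3_def)
next
  case True
  then obtain i0 j0 where ij0: "quad i0 j0" by blast
  define R where "R = {i \<in> row_set P. r < i \<and> (i, c) \<in> S}"
  define C where "C = {j \<in> col_set P. j < c \<and> (r, j) \<in> S}"
  have fin: "finite R" "finite C"
    using pat by (auto simp: R_def C_def is_pattern_def)
  have in0: "i0 \<in> R" "j0 \<in> C"
    using ij0 S_sub by (auto simp: R_def C_def quad_def)
  define p where "p = Min R"
  define y where "y = Max C"
  have p: "p \<in> R" and y: "y \<in> C"
    using fin in0 unfolding p_def y_def by (auto intro!: Min_in Max_in)
  have p_le: "\<forall>i. r < i \<longrightarrow> (i, c) \<in> S \<longrightarrow> p \<le> i"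
    using fin S_sub unfolding p_def R_def by (auto intro!: Min_le)
  have le_y: "\<forall>j. j < c \<longrightarrow> (r, j) \<in> S \<longrightarrow> j \<le> y"
    using fin S_sub unfolding y_def C_def by (auto intro!: Max_ge)
  \<comment> \<open>The staircase leads from \<open>(i0, j0)\<close> to row \<open>p\<close> and
    then to column \<open>y\<close>.\<close>
  have "quad p j0"
    using quad_up[OF ij0, of p] p p_le ij0 by (auto simp: R_def quad_def)
  then have py: "quad p y"
    using quad_right[of p j0 y] y le_y ij0 by (auto simp: C_def quad_def)
  define u where "u = A (r, y) * A (p, c) / A (p, y)"
  have pos: "0 < A (p, y)" "0 < A (r, y)" "0 < A (p, c)"
    using py pos_1 by (auto simp: quad_def)
  then have u: "0 < u" "u * A (p, y) = A (r, y) * A (p, c)"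
    by (auto simp: u_def)
  note lub = least_upper_bound[OF py p_le le_y u(2)]
  have "\<forall>\<^sub>F v in at_left u. \<forall>x\<in>{(i, i', j, j'). block_3 i i' j j'}.
      case x of (i, i', j, j') \<Rightarrow> 0 < det_3 i i' j j' v"
  proof (rule eventually_ball_finite[OF finite_block_3], safe)
    fix i i' j j' assume "block_3 i i' j j'"
    then have "0 < det_3 i i' j j' u"
      using lub(2) by blast
    moreover have "(det_3 i i' j j' \<longlongrightarrow> det_3 i i' j j' u) (at_left u)"
      unfolding det_3_def by (intro tendsto_intros)
    ultimately show "\<forall>\<^sub>F v in at_left u. 0 < det_3 i i' j j' v"
      by (simp add: order_tendstoD(1))
  qed
  moreover have "\<forall>\<^sub>F v in at_left u. 0 < v \<and> v < u"
    using eventually_at_left_real[OF u(1)] by (rule eventually_mono) simp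
  ultimately have "\<forall>\<^sub>F v in at_left u. 0 < v \<and> v < u \<and>
      (\<forall>i i' j j'. block_3 i i' j j' \<longrightarrow> 0 < det_3 i i' j j' v)"
    by eventually_elim auto
  then obtain v where v: "0 < v" "v < u" "\<forall>i i' j j'. block_3 i i' j j' \<longrightarrow> 0 < det_3 i i' j j' v"
    using eventually_happens'[OF trivial_limit_at_left_real] by blast
  moreover have "v * A (i, j) < A (r, j) * A (i, c)" if "quad i j" for i j
  proof -
    have "v * A (i, j) < u * A (i, j)"
      using v(2) that pos_1 by (auto simp: quad_def)
    then show ?thesis
      using lub(1)[OF that] by simp
  qed
  ultimately show ?thesis
    by blast
qed

text \<open>Of the four quadrants around the gap, two would put it on the diagonal of a two by two
  submatrix and a third into a lower left corner.\<close>

lemma quad_if_minor: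
  assumes sub: "I \<times> J \<subseteq> insert (r, c) S" and rc: "r \<in> I" "c \<in> J"
    and ij: "i \<in> I - {r}" "j \<in> J - {c}"
  shows "quad i j"
proof -
  have S: "(r, j) \<in> S" "(i, c) \<in> S" "(i, j) \<in> S"
    using assms by auto
  have "\<not> (i < r \<and> j < c)"
    using S specified_lower_right[OF no_gap pat, of i r j c] gap by blast
  moreover have "\<not> (r < i \<and> c < j)"
    using S specified_upper_left[OF no_gap pat, of r i c j] gap by blast
  moreover have "\<not> (i < r \<and> c < j)"
    using S no_lower_left by blast
  ultimately have "r < i" "j < c"
    using ij by auto
  then show ?thesis
    using S by (simp add: quad_def)
qed

text \<open>Minors avoiding the gap are minors of \<open>A\<close>. Those through it have size one,
  two or three, and \<open>ex_value\<close> treats exactly these.\<close>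

lemma ex_partial_TP: "\<exists>v. partial_TP (specify P {(r, c)}) (A((r, c) := v))"
proof -
  obtain v where v: "0 < v" "\<And>i j. quad i j \<Longrightarrow> v * A (i, j) < A (r, j) * A (i, c)"
    "\<And>i i' j j'. block_3 i i' j j' \<Longrightarrow> 0 < det_3 i i' j j' v"
    using ex_value by blast
  let ?B = "A((r, c) := v)"
  have "partial_TP (specify P {(r, c)}) ?B"
    unfolding partial_TP_def
  proof (intro allI impI, elim conjE)
    fix I J
    assume "I \<subseteq> row_set (specify P {(r, c)})" "J \<subseteq> col_set (specify P {(r, c)})"
      and card: "card I = card J" and "I \<times> J \<subseteq> specified (specify P {(r, c)})"
    then have IJ: "I \<subseteq> row_set P" "J \<subseteq> col_set P" and sub: "I \<times> J \<subseteq> insert (r, c) S"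
      by (auto simp: specify_def)
    have fin: "finite I" "finite J"
      using IJ pat finite_subset unfolding is_pattern_def by blast+
    show "0 < minor ?B I J"
    proof (cases "r \<in> I \<and> c \<in> J")
      case False
      then have "minor ?B I J = minor A I J"
        by (intro minor_cong card) auto
      moreover have "I \<times> J \<subseteq> S"
        using sub False by auto
      ultimately show ?thesis
        using TP card IJ by (simp add: partial_TP_def)
    next
      case True
      define I' where "I' = I - {r}"
      define J' where "J' = J - {c}"
      have I: "I = insert r I'" and J: "J = insert c J'"
        using True by (auto simp: I'_def J'_def)
      have card': "card I' = card J'"
        using card True fin by (simp add: I'_def J'_def)
      have quad: "quad i j" if "i \<in> I'" "j \<in> J'" for i j
        using quad_if_minor[OF sub] True that unfolding I'_def J'_def by blast
      have fin': "finite I'" "finite J'"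
        using fin by (auto simp: I'_def J'_def)
      have "\<not> 3 \<le> card I'"
      proof
        assume "3 \<le> card I'"
        then obtain X Y where "X \<subseteq> I'" "card X = 3" "Y \<subseteq> J'" "card Y = 3"
          using card' obtain_subset_with_card_n by metis
        then obtain a b d w x y where "a < b" "b < d" "{a, b, d} \<subseteq> I'"
          "w < x" "x < y" "{w, x, y} \<subseteq> J'"
          by (metis card_3_sorted)
        then show False
          using no_4_block[of a b d w x y] quad by blast
      qed
      then consider "card I' = 0" | "card I' = 1" | "card I' = 2"
        by linarith
      then show ?thesis
      proof cases
        case 1
        then show ?thesis
          using card' fin' v(1) by (simp add: I J minor_1)
      next
        case 2
        then obtain i j where ij: "I' = {i}" "J' = {j}"
          using card' by (metis card_1_singletonE)
        then have q: "quad i j"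
          using quad by blast
        then have "r < i" "j < c"
          by (auto simp: quad_def)
        moreover have "I = {r, i}" "J = {j, c}"
          using I J ij by auto
        ultimately show ?thesis
          using v(2)[OF q] by (simp add: minor_2)
      next
        case 3
        obtain i i' where i: "i < i'" "I' = {i, i'}"
          using card_2_sorted 3 by blast
        obtain j j' where j: "j < j'" "J' = {j, j'}"
          using card_2_sorted 3 card' by metis
        have "block_3 i i' j j'"
          using i j quad by (simp add: block_3_def)
        moreover have "r < i" "j' < c"
          using i j quad by (auto simp: quad_def)
        moreover have "I = {r, i, i'}" "J = {j, j', c}"
          using I J i j by auto
        ultimately show ?thesis
          using v(3)[of i i' j j'] i j by (simp add: minor_3 det_3_def)
      qed
    qed
  qed
  then show ?thesis ..
qed

end

section \<open>Arbitrary gaps and the conclusion\<close>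

text \<open>The gap cannot be both a lower left and an upper right corner of otherwise specified two
  by two submatrices, so the locale applies to \<open>P\<close> or to its transpose.\<close>

lemma TP_completable_single:
  assumes no_gap: "\<not> has_single_gap_nonTN P" and pat: "is_pattern P" and u: "u \<in> unspecified P"
  shows "TP_completable_subset P {u}"
  unfolding TP_completable_subset_def
proof (intro allI impI)
  fix A assume TP: "partial_TP P A"
  obtain r c where rc: "u = (r, c)" "r \<in> row_set P" "c \<in> col_set P" "(r, c) \<notin> specified P"
    using u by (auto simp: unspecified_def)
  let ?S = "specified P"
  have "\<exists>v. partial_TP (specify P {u}) (A(u := v))"
  proof (cases "\<exists>i j. i < r \<and> c < j \<and> (i, c) \<in> ?S \<and> (r, j) \<in> ?S \<and> (i, j) \<in> ?S")
    case False
    then interpret upper_right_gap P A r c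
      by unfold_locales (use no_gap pat TP rc in auto)
    show ?thesis
      using ex_partial_TP rc(1) by simp
  next
    case True
    then obtain i' j' where 1: "i' < r" "c < j'" "(i', c) \<in> ?S" "(r, j') \<in> ?S" "(i', j') \<in> ?S"
      by blast
    have no_ur: False
      if 2: "r < i" "j < c" "(i, c) \<in> ?S" "(r, j) \<in> ?S" "(i, j) \<in> ?S" for i j
    proof -
      \<comment> \<open>Columns \<open>j < j'\<close> force the corner \<open>(i, j')\<close>; then
        columns \<open>c < j'\<close> force the gap itself to be specified.\<close>
      have "(i, j') \<in> ?S"
        using specified_lower_right[OF no_gap pat, of r i j j'] 1 2 by simp
      then show False
        using specified_upper_left[OF no_gap pat, of r i c j'] 1 2 rc by simp
    qed
    interpret T: upper_right_gap "transpose_pattern P" "A \<circ> prod.swap" c r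
      using no_gap pat TP rc no_ur has_single_gap_nonTN_transpose partial_TP_transpose
      by unfold_locales (auto simp: is_pattern_transpose)
    obtain v where "partial_TP (specify (transpose_pattern P) {(c, r)}) ((A \<circ> prod.swap)((c, r) := v))"
      using T.ex_partial_TP by blast
    from partial_TP_transpose[OF this]
    have "partial_TP (specify P {(r, c)}) ((A \<circ> prod.swap)((c, r) := v) \<circ> prod.swap)"
      by (simp add: transpose_specify converse_singleton)
    also have "(A \<circ> prod.swap)((c, r) := v) \<circ> prod.swap = A((r, c) := v)"
      by (auto simp: fun_eq_iff)
    finally show ?thesis
      using rc(1) by blast
  qed
  then obtain v where "partial_TP (specify P {u}) (A(u := v))" ..
  moreover have "\<forall>p\<in>?S. (A(u := v)) p = A p"
    using rc by auto
  ultimately show "\<exists>B. (\<forall>p\<in>?S. B p = A p) \<and> partial_TP (specify P {u}) B"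
    by blast
qed

theorem theorem11:
  fixes P :: pattern
  assumes "TP_obstruction P"
    and "TP_variability P = 1"
  shows "\<exists>I J. I \<subseteq> row_set P \<and> J \<subseteq> col_set P \<and>
    TN_obstruction (subpattern P I J) \<and> TN_variability (subpattern P I J) = 1"
proof -
  have P: "is_pattern P" "\<not> TP_completable P"
    using assms(1) by (auto simp: TP_obstruction_def)
  \<comment> \<open>The set of all unspecified positions is a candidate, so the minimum defining the
    variability is attained, here by a singleton.\<close>
  then have "\<exists>k. \<exists>U\<subseteq>unspecified P. \<not> TP_completable_subset P U \<and> card U = k"
    using TP_completable_subset_unspecified by blast
  from LeastI_ex[OF this] obtain U
    where "U \<subseteq> unspecified P" "\<not> TP_completable_subset P U" "card U = TP_variability P"
    unfolding TP_variability_def by blast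
  with assms(2) obtain u where "u \<in> unspecified P" "\<not> TP_completable_subset P {u}"
    by (metis card_1_singletonE insert_subset)
  then have "has_single_gap_nonTN P"
    using TP_completable_single P by blast
  then show ?thesis
    by (rule TN_obstruction_if_single_gap[OF P(1)])
qed

end
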